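(* Let $h=(h(n))_{n\ge1}$ be a sequence of positive real numbers with $h(1)=1$. For every $n\ge 2$, \[ P_n^h(-z)=\frac{(-1)^n\,z}{\prod_{k=1}^n h(k)}\,\det\!\left(zI_{n-1}-M_n^h\right), \] where $I_{n-1}$ is the identity matrix of size $n-1$. Moreover, the matrix $M_n^h$ has nonnegative entries.
   Context: Let $\sigma(k)=\sum_{d\mid k}d$. The generalized D'Arcais polynomials are defined by $P_0^h(z)=1$ and $P_n^h(z)=\frac{z}{h(n)}\sum_{k=1}^n\sigma(k)P_{n-k}^h(z)$ for $n\ge1$. The sequence $(c_n)_{n\ge0}$ is defined by $c_0:=1$ and \[ c_n:=\sum_{k=0}^{n-1}(-1)^{n-k+1}\sigma(n-k+1)\,c_k,\qquad n\ge1. \] For $n\ge2$, $M_n^h$ is the $(n-1)\times(n-1)$ matrix with entries, for $1\le i,j\le n-1$, \[ (M_n^h)_{ij}=\begin{cases} c_{i-j+1}\,h(j), & i\ge j-1,\\ 0, & j>i+1.\end{cases} \] *)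

theory Defs
  imports "Jordan_Normal_Form.Determinant"
begin

text \<open>Intended for \<open>k \<ge> 1\<close>; the set of divisors of \<open>0\<close> is infinite.\<close>

definition sigma :: "nat \<Rightarrow> nat" where
  "sigma k = \<Sum>{d. d dvd k}"

fun dArcais :: "(nat \<Rightarrow> real) \<Rightarrow> nat \<Rightarrow> real poly" where
  "dArcais h 0 = 1"
| "dArcais h (Suc n) =
     smult (1 / h (Suc n))
       ([:0, 1:] * (\<Sum>k = 1..Suc n. of_nat (sigma k) * dArcais h (Suc n - k)))"

fun c_seq :: "nat \<Rightarrow> int" where
  "c_seq 0 = 1"
| "c_seq (Suc n) =
     (\<Sum>k = 0..n. (-1) ^ (Suc n - k + 1) * int (sigma (Suc n - k + 1)) * c_seq k)"

text \<open>Matrices of type \<^typ>\<open>'a mat\<close> are indexed from \<open>0\<close>, so the entry in row \<open>i\<close> and column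
  \<open>j\<close> of the usual 1-based convention is found at \<open>(i - 1, j - 1)\<close>.\<close>

definition M_entry :: "(nat \<Rightarrow> real) \<Rightarrow> nat \<Rightarrow> nat \<Rightarrow> real" where
  "M_entry h i j = (if j \<le> i + 1 then of_int (c_seq (i + 1 - j)) * h j else 0)"

definition M_mat :: "(nat \<Rightarrow> real) \<Rightarrow> nat \<Rightarrow> real mat" where
  "M_mat h n = mat (n - 1) (n - 1) (\<lambda>(i, j). M_entry h (i + 1) (j + 1))"

end

theory Submission
  imports Defs "HOL-Computational_Algebra.Formal_Power_Series"
begin

text \<open>Put \<open>g m = (-1)\<^sup>m \<sigma>(m + 1)\<close>, so that \<open>\<Sum>c\<^sub>n t\<^sup>n\<close> is the inverse of \<open>G = \<Sum>g m t\<^sup>m\<close>. Inverting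
  the recurrence of \<open>(-1)\<^sup>n P\<^sub>n(-z)\<close> and dividing by \<open>z\<close> shows that the vector of these polynomials for
  \<open>1 \<le> n < N\<close> is mapped by \<open>z I - M\<^sub>N\<close> to a vector supported in the last coordinate, with entry
  \<open>h(N) (-1)\<^sup>N P\<^sub>N(-z) / z\<close>. Replacing the first column of the Hessenberg matrix \<open>z I - M\<^sub>N\<close> by this
  image leaves the determinant unchanged, as the first coordinate of the vector is \<open>1\<close>, and makes it a
  product.

  For the signs, \<open>(1 - 3 t\<^sup>2 - 2 t\<^sup>3) G = 1 - 3 t + t\<^sup>2 + \<Sum>\<^bsub>j\<ge>5\<^esub> e\<^sub>j t\<^sup>j\<close>, where the \<open>e\<^sub>j\<close> grow only
  quadratically and are so small that the recurrence
  \<open>c\<^sub>n = 3 c\<^bsub>n-1\<^esub> - c\<^bsub>n-2\<^esub> - \<Sum>\<^bsub>j\<ge>5\<^esub> e\<^sub>j c\<^bsub>n-j\<^esub>\<close> forces growth by a factor of at least \<open>11/5\<close> from \<open>n = 6\<close> on.\<close>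

section \<open>Determinants of Hessenberg matrices\<close>

text \<open>Only the last entry of the replaced first column can be nonzero, so Laplace expansion
  along it leaves one minor. The sign of its cofactor is spread over the \<open>m\<close> factors of
  the product.\<close>

lemma det_hessenberg:
  fixes A :: "'a :: idom mat"
  assumes A: "A \<in> carrier_mat (Suc m) (Suc m)"
    and hess: "\<And>i j. i < Suc m \<Longrightarrow> j < Suc m \<Longrightarrow> Suc i < j \<Longrightarrow> A $$ (i, j) = 0"
    and v: "v \<in> carrier_vec (Suc m)" "v $ 0 = 1"
    and Av: "\<And>i. i < m \<Longrightarrow> (A *\<^sub>v v) $ i = 0"
  shows "det A = (A *\<^sub>v v) $ m * (\<Prod>i<m. - A $$ (i, Suc i))"
proof -
  \<comment> \<open>\<open>A * T\<close> is \<open>A\<close> with its first column replaced by \<open>A *\<^sub>v v\<close>.\<close>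
  define T where "T = mat (Suc m) (Suc m) (\<lambda>(i, j). if j = 0 then v $ i else if i = j then 1 else 0)"
  define B where "B = A * T"
  have T: "T \<in> carrier_mat (Suc m) (Suc m)" and B: "B \<in> carrier_mat (Suc m) (Suc m)"
    using A by (auto simp: T_def B_def)
  have "det T = prod_list (diag_mat T)"
    by (rule det_lower_triangular[OF _ T]) (auto simp: T_def)
  also have "diag_mat T = replicate (Suc m) 1"
    using v(2) by (intro nth_equalityI) (auto simp: diag_mat_def T_def simp del: upt_Suc replicate_Suc)
  finally have "det T = 1" by simp
  then have detB: "det B = det A"
    using det_mult[OF A T] by (simp add: B_def)
  have B0: "B $$ (i, 0) = (A *\<^sub>v v) $ i" if "i < Suc m" for i
  proof -
    have "col T 0 = v"
      using v(1) by (intro eq_vecI) (auto simp: T_def)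
    then show ?thesis
      using A T that by (simp add: B_def)
  qed
  have BS: "B $$ (i, Suc j) = A $$ (i, Suc j)" if "i < Suc m" "j < m" for i j
  proof -
    have "col T (Suc j) = unit_vec (Suc m) (Suc j)"
      using that by (intro eq_vecI) (auto simp: T_def unit_vec_def)
    then show ?thesis
      using A T that by (simp add: B_def)
  qed
  \<comment> \<open>Deleting the last row and first column moves the superdiagonal onto the
    diagonal, so the Hessenberg condition makes \<open>L\<close> lower triangular.\<close>
  define L where "L = mat_delete B m 0"
  have L: "L \<in> carrier_mat m m"
    using B by (simp add: L_def mat_delete_def)
  have L_entry: "L $$ (i, j) = A $$ (i, Suc j)" if "i < m" "j < m" for i j
    using B BS that by (simp add: L_def mat_delete_def)
  have "det L = prod_list (diag_mat L)"
    using hess by (intro det_lower_triangular[OF _ L]) (simp add: L_entry)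
  also have "diag_mat L = map (\<lambda>i. A $$ (i, Suc i)) [0..<m]"
    using L by (intro nth_equalityI) (auto simp: diag_mat_def L_entry)
  also have "prod_list \<dots> = (\<Prod>i<m. A $$ (i, Suc i))"
    by (simp add: prod.distinct_set_conv_list[symmetric] lessThan_atLeast0)
  finally have detL: "det L = (\<Prod>i<m. A $$ (i, Suc i))" .
  have "det B = (\<Sum>i<Suc m. B $$ (i, 0) * cofactor B i 0)"
    by (rule laplace_expansion_column[OF B]) simp
  also have "\<dots> = (A *\<^sub>v v) $ m * cofactor B m 0"
    using Av by (simp add: B0)
  also have "\<dots> = (A *\<^sub>v v) $ m * ((-1) ^ m * (\<Prod>i<m. A $$ (i, Suc i)))"
    by (simp add: cofactor_def detL flip: L_def)
  also have "(-1) ^ m * (\<Prod>i<m. A $$ (i, Suc i)) = (\<Prod>i<m. - A $$ (i, Suc i))"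
    by (simp add: prod_uminus)
  finally show ?thesis
    using detB by simp
qed

section \<open>The power series inverse to \<open>c_seq\<close>\<close>

definition sigma_alt :: "nat \<Rightarrow> int" where
  "sigma_alt m = (-1) ^ m * int (sigma (Suc m))"

lemma sigma_alt_0 [simp]: "sigma_alt 0 = 1"
  by (simp add: sigma_alt_def sigma_def)

text \<open>The recurrence of \<open>c_seq\<close> says that the coefficients of positive index
  vanish. A general ring is allowed because both integers and real polynomials occur below.\<close>

lemma c_seq_mult_sigma_alt:
  "Abs_fps (\<lambda>n. of_int (c_seq n)) * Abs_fps (\<lambda>n. of_int (sigma_alt n)) = (1 :: 'a :: comm_ring_1 fps)"
proof (rule fps_ext)
  fix n
  have "(\<Sum>i = 0..n. c_seq i * sigma_alt (n - i)) = (if n = 0 then 1 else 0)"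
  proof (cases n)
    case (Suc m)
    \<comment> \<open>The exponent of -1 in \<open>c_seq\<close> exceeds that in
      \<open>sigma_alt\<close> by one.\<close>
    have "c_seq (Suc m) = - (\<Sum>i = 0..m. c_seq i * sigma_alt (Suc m - i))"
      by (simp add: sigma_alt_def sum_negf mult_ac flip: sum_negf)
    then show ?thesis
      using Suc by simp
  qed simp
  then have "(of_int (\<Sum>i = 0..n. c_seq i * sigma_alt (n - i)) :: 'a) = (if n = 0 then 1 else 0)"
    by simp
  then show "fps_nth (Abs_fps (\<lambda>n. of_int (c_seq n)) * Abs_fps (\<lambda>n. of_int (sigma_alt n))) n
    = fps_nth (1 :: 'a fps) n"
    by (simp add: fps_mult_nth)
qed

lemma c_seq_convolution_inverse:
  fixes a :: "nat \<Rightarrow> 'a :: comm_ring_1"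
  assumes "\<And>n. b n = (\<Sum>k\<le>n. of_int (sigma_alt k) * a (n - k))"
  shows "(\<Sum>k\<le>n. of_int (c_seq k) * b (n - k)) = a n"
proof -
  have "Abs_fps b = Abs_fps (\<lambda>n. of_int (sigma_alt n)) * Abs_fps a"
    by (rule fps_ext) (simp add: assms fps_mult_nth atMost_atLeast0)
  then have "Abs_fps (\<lambda>n. of_int (c_seq n)) * Abs_fps b = Abs_fps a"
    by (simp add: c_seq_mult_sigma_alt flip: mult.assoc)
  then have "fps_nth (Abs_fps (\<lambda>n. of_int (c_seq n)) * Abs_fps b) n = a n"
    by simp
  then show ?thesis
    by (simp add: fps_mult_nth atMost_atLeast0)
qed

section \<open>Growth and nonnegativity of \<open>c_seq\<close>\<close>

text \<open>The coefficients of \<open>(1 - 3 t\<^sup>2 - 2 t\<^sup>3) G\<close>; the multiplier was found by a numerical search.\<close>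

definition e_seq :: "nat \<Rightarrow> int" where
  "e_seq j = sigma_alt j - (if j < 2 then 0 else 3 * sigma_alt (j - 2))
     - (if j < 3 then 0 else 2 * sigma_alt (j - 3))"

text \<open>The product of the two series is the multiplier itself, a polynomial of degree
  3.\<close>

lemma c_seq_e_seq:
  assumes "n \<ge> 4"
  shows "(\<Sum>j\<le>n. e_seq j * c_seq (n - j)) = 0"
proof -
  let ?A = "1 - fps_const 3 * fps_X ^ 2 - fps_const 2 * fps_X ^ 3 :: int fps"
  have "Abs_fps e_seq = ?A * Abs_fps sigma_alt"
    by (rule fps_ext)
      (simp add: e_seq_def left_diff_distrib mult.assoc fps_X_power_mult_nth)
  moreover have "Abs_fps sigma_alt * Abs_fps c_seq = 1"
    using c_seq_mult_sigma_alt[where 'a = int] by (simp add: mult.commute)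
  ultimately have "Abs_fps e_seq * Abs_fps c_seq = ?A"
    by (simp add: mult.assoc)
  then have "fps_nth (Abs_fps e_seq * Abs_fps c_seq) n = fps_nth ?A n"
    by simp
  also have "fps_nth ?A n = 0"
    using assms by simp
  finally show ?thesis
    by (simp add: fps_mult_nth atMost_atLeast0)
qed

text \<open>An executable form of \<open>sigma\<close>, for the evaluations by
  \<open>code_simp\<close>.\<close>

lemma sigma_eq [code]: "sigma n = (\<Sum>d = 1..n. if d dvd n then d else 0)"
proof (cases "n = 0")
  case False
  then have "{d. d dvd n} = {d \<in> {1..n}. d dvd n}"
    by (auto dest: dvd_imp_le intro: Suc_leI dvd_pos_nat)
  then show ?thesis
    by (simp only: sigma_def sum.inter_filter finite_atLeastAtMost)
\<comment> \<open>The sum over the infinite set of divisors of 0 is 0 by convention.\<close>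
qed (simp add: sigma_def)

lemma sigma_le: "sigma n \<le> n\<^sup>2"
proof -
  have "sigma n \<le> (\<Sum>d = 1..n. n)"
    unfolding sigma_eq by (rule sum_mono) auto
  then show ?thesis
    by (simp add: power2_eq_square)
qed

text \<open>The first five values give the recurrence of \<open>c_seq\<close>; the others are the
  explicit head of the weighted sum.\<close>

lemma e_seq_small: "map e_seq [0..<16] = [1, -3, 1, 0, 0, 1, 4, 9, 13, 11, 3, 0, 14, 36, 38, 13]"
  by code_simp

lemma c_seq_small: "map c_seq [0..<7] = [1, 3, 5, 10, 25, 64, 160]"
  by code_simp

lemma abs_e_seq_le:
  assumes "j \<ge> 3"
  shows "\<bar>e_seq j\<bar> \<le> 3 * (int j + 1)\<^sup>2"
proof -
  define m where "m = j - 3"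
  have j: "j = m + 3" using assms by (simp add: m_def)
  have "e_seq j = (-1) ^ j * (int (sigma (m + 4)) - 3 * int (sigma (m + 2)) + 2 * int (sigma (m + 1)))"
    unfolding e_seq_def sigma_alt_def j by (simp add: algebra_simps eval_nat_numeral)
  then have "\<bar>e_seq j\<bar> = \<bar>int (sigma (m + 4)) - 3 * int (sigma (m + 2)) + 2 * int (sigma (m + 1))\<bar>"
    by (simp add: abs_mult)
  moreover have "int (sigma k) \<le> (int k)\<^sup>2" for k
    using sigma_le[of k] by (metis of_nat_le_iff of_nat_power)
  note this[of "m + 4"] this[of "m + 2"] this[of "m + 1"]
  \<comment> \<open>The positive terms and the negative term are bounded separately.\<close>
  moreover have "3 * (int j + 1)\<^sup>2 \<ge> (int (m + 4))\<^sup>2 + 2 * (int (m + 1))\<^sup>2"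
    and "3 * (int j + 1)\<^sup>2 \<ge> 3 * (int (m + 2))\<^sup>2"
    by (simp_all add: j power2_eq_square algebra_simps)
  ultimately show ?thesis by linarith
qed

text \<open>Telescopes: \<open>6 (k + 2)\<^sup>2 (5/11)\<^sup>k\<close> decreases by at least \<open>3 (k + 1)\<^sup>2 (5/11)\<^sup>k\<close> at each step.\<close>

lemma e_seq_tail:
  assumes "N \<ge> 3"
  shows "(\<Sum>j = N..<N + n. \<bar>real_of_int (e_seq j)\<bar> * (5 / 11) ^ j)
    + 6 * (real (N + n) + 2)\<^sup>2 * (5 / 11) ^ (N + n) \<le> 6 * (real N + 2)\<^sup>2 * (5 / 11) ^ N"
proof (induction n)
  case (Suc n)
  define k where "k = N + n"
  have "N \<le> k" and k: "k \<ge> 3" using assms by (simp_all add: k_def)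
  have "\<bar>real_of_int (e_seq k)\<bar> \<le> 3 * (real k + 1)\<^sup>2"
  proof -
    have "real_of_int \<bar>e_seq k\<bar> \<le> real_of_int (3 * (int k + 1)\<^sup>2)"
      using abs_e_seq_le[OF k] by (simp only: of_int_le_iff)
    then show ?thesis by simp
  qed
  moreover have "3 * (real k + 1)\<^sup>2 + 6 * (real k + 3)\<^sup>2 * (5 / 11) \<le> 6 * (real k + 2)\<^sup>2"
  proof -
    have expand: "(real k + a)\<^sup>2 = real k * real k + 2 * a * real k + a * a" for a
      by (simp add: power2_eq_square algebra_simps)
    \<comment> \<open>Multiplied by 11, right side minus left side is
      \<open>3 * k^2 + 18 * k - 39\<close>.\<close>
    have "39 \<le> 0 + real k * 18" using k by simp
    also have "\<dots> \<le> real k * (real k * 3) + real k * 18" by (intro add_right_mono) simp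
    finally show ?thesis unfolding expand by (simp add: field_simps)
  qed
  ultimately have "\<bar>real_of_int (e_seq k)\<bar> + 6 * (real k + 3)\<^sup>2 * (5 / 11) \<le> 6 * (real k + 2)\<^sup>2"
    by linarith
  then have "(\<bar>real_of_int (e_seq k)\<bar> + 6 * (real k + 3)\<^sup>2 * (5 / 11)) * (5 / 11) ^ k
      \<le> 6 * (real k + 2)\<^sup>2 * (5 / 11) ^ k"
    by (rule mult_right_mono) simp
  with Suc \<open>N \<le> k\<close> show ?case
    by (simp add: algebra_simps flip: k_def)
qed simp

text \<open>The terms below 16 are evaluated; \<open>e_seq_tail\<close> bounds the rest. The value
  3/20 is small enough for the growth step below.\<close>

lemma e_seq_weighted_sum: "(\<Sum>j = 5..<n. \<bar>real_of_int (e_seq j)\<bar> * (5 / 11) ^ j) \<le> 3 / 20"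
proof -
  let ?f = "\<lambda>j. \<bar>real_of_int (e_seq j)\<bar> * (5 / 11) ^ j"
  have "sum ?f {5..<n} \<le> sum ?f {5..<16 + n}"
    by (rule sum_mono2) auto
  also have "\<dots> = sum ?f {5..<16} + sum ?f {16..<16 + n}"
    by (simp add: sum.atLeastLessThan_concat)
  also have "sum ?f {5..<16} \<le> 13 / 100"
  proof -
    have "e_seq j = map e_seq [0..<16] ! j" if "j < 16" for j
      using that by simp
    then have "sum ?f {5..<16} = (\<Sum>j = 5..<16. \<bar>real_of_int
        ([1, -3, 1, 0, 0, 1, 4, 9, 13, 11, 3, 0, 14, 36, 38, 13] ! j)\<bar> * (5 / 11) ^ j)"
      unfolding e_seq_small by (intro sum.cong) auto
    also have "\<dots> \<le> 13 / 100"
      by (simp add: sum.atLeastLessThan_Suc eval_nat_numeral field_simps)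
    finally show ?thesis .
  qed
  also have "sum ?f {16..<16 + n} \<le> 1 / 50"
  proof -
    have "sum ?f {16..<16 + n} \<le> 6 * (real 16 + 2)\<^sup>2 * (5 / 11) ^ 16"
      by (rule order_trans[OF _ e_seq_tail[of 16 n]]) simp_all
    also have "\<dots> \<le> 1 / 50"
      by (simp add: power_divide)
    finally show ?thesis .
  qed
  finally show ?thesis by simp
qed

text \<open>Every earlier term is compared with \<open>c_seq n\<close>, not only its predecessor:
  some early ratios are below 11/5, such as 10/5. The induction starts at 6 because at 5 the
  comparison fails: \<open>3 > 64 * (5/11)^4\<close>.\<close>

lemma c_seq_growth:
  assumes "n \<ge> 6" "j \<le> n"
  shows "0 \<le> c_seq j" "real_of_int (c_seq j) \<le> real_of_int (c_seq n) * (5 / 11) ^ (n - j)"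
proof -
  have "\<forall>j\<le>n. 0 \<le> c_seq j \<and> real_of_int (c_seq j) \<le> real_of_int (c_seq n) * (5 / 11) ^ (n - j)"
    using assms(1)
  proof (induction n rule: dec_induct)
    case base
    have "c_seq j = [1, 3, 5, 10, 25, 64, 160] ! j" if "j < 7" for j
      using that by (simp flip: c_seq_small)
    moreover have "\<forall>j<7. 0 \<le> ([1, 3, 5, 10, 25, 64, 160] ! j :: int) \<and>
        real_of_int ([1, 3, 5, 10, 25, 64, 160] ! j) \<le> 160 * (5 / 11) ^ (6 - j)"
      by (simp add: All_less_Suc eval_nat_numeral)
    ultimately show ?case
      by auto
  next
    case (step n)
    define c where "c k = real_of_int (c_seq k)" for k
    define s where "s = (\<Sum>j = 5..Suc n. real_of_int (e_seq j) * c (Suc n - j))"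
    have c: "0 \<le> c j" "c j \<le> c n * (5 / 11) ^ (n - j)" if "j \<le> n" for j
      using step.IH that by (auto simp: c_def)
    have "0 = real_of_int (\<Sum>j\<le>Suc n. e_seq j * c_seq (Suc n - j))"
      using step.hyps by (subst c_seq_e_seq) auto
    also have "\<dots> = (\<Sum>j = 0..Suc n. real_of_int (e_seq j) * c (Suc n - j))"
      by (simp add: c_def atMost_atLeast0)
    also have "\<dots> = (\<Sum>j = 0..<5. real_of_int (e_seq j) * c (Suc n - j)) + s"
      using step.hyps by (simp add: s_def sum.atLeastLessThan_concat flip: atLeastLessThanSuc_atLeastAtMost)
    also have "(\<Sum>j = 0..<5. real_of_int (e_seq j) * c (Suc n - j)) = c (Suc n) - 3 * c n + c (n - 1)"
      using e_seq_small by (simp add: eval_nat_numeral)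
    finally have rec: "c (Suc n) = 3 * c n - c (n - 1) - s"
      by simp
    \<comment> \<open>Since \<open>Suc n - j = n - (j - 1)\<close>, the hypothesis yields the power
      \<open>j - 1\<close> of 5/11, hence the factor 11/5.\<close>
    have "s \<le> (\<Sum>j = 5..Suc n. c n * (11 / 5) * (\<bar>real_of_int (e_seq j)\<bar> * (5 / 11) ^ j))"
      unfolding s_def
    proof (rule sum_mono)
      fix j assume j: "j \<in> {5..Suc n}"
      then obtain i where i: "j = Suc i" "i \<le> n" by (cases j) auto
      have "real_of_int (e_seq j) * c (Suc n - j) \<le> \<bar>real_of_int (e_seq j)\<bar> * c (n - i)"
        using c(1)[of "n - i"] i by (auto intro: mult_right_mono)
      also have "\<dots> \<le> \<bar>real_of_int (e_seq j)\<bar> * (c n * (5 / 11) ^ i)"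
        using c(2)[of "n - i"] i by (intro mult_left_mono) auto
      finally show "real_of_int (e_seq j) * c (Suc n - j)
          \<le> c n * (11 / 5) * (\<bar>real_of_int (e_seq j)\<bar> * (5 / 11) ^ j)"
        by (simp add: i(1) mult_ac)
    qed
    also have "\<dots> \<le> c n * (11 / 5) * (3 / 20)"
      unfolding sum_distrib_left[symmetric] atLeastLessThanSuc_atLeastAtMost[symmetric]
      using c(1)[of n] by (intro mult_left_mono e_seq_weighted_sum) auto
    finally have "s \<le> c n * (11 / 5) * (3 / 20)" .
    moreover have "c (n - 1) \<le> c n * (5 / 11)"
      using c(2)[of "n - 1"] step.hyps(1) by simp
    \<comment> \<open>Here \<open>3 - 5/11 - 11/5 * 3/20 \<ge> 11/5\<close>.\<close>
    ultimately have growth: "11 / 5 * c n \<le> c (Suc n)"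
      using rec c(1)[of n] by linarith
    show ?case
    proof (intro allI impI)
      fix j assume "j \<le> Suc n"
      then consider "j \<le> n" | "j = Suc n" by linarith
      then have "0 \<le> c j \<and> c j \<le> c (Suc n) * (5 / 11) ^ (Suc n - j)"
      proof cases
        case 1
        have "c n * (5 / 11) ^ (n - j) \<le> (5 / 11 * c (Suc n)) * (5 / 11) ^ (n - j)"
          using growth by (intro mult_right_mono) auto
        also have "\<dots> = c (Suc n) * (5 / 11) ^ (Suc n - j)"
          using 1 by (simp add: Suc_diff_le)
        finally show ?thesis
          using c[OF 1] by linarith
      next
        case 2
        then show ?thesis using growth c(1)[of n] by simp
      qed
      then show "0 \<le> c_seq j \<and> real_of_int (c_seq j) \<le> real_of_int (c_seq (Suc n)) * (5 / 11) ^ (Suc n - j)"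
        by (simp add: c_def)
    qed
  qed
  then show "0 \<le> c_seq j" "real_of_int (c_seq j) \<le> real_of_int (c_seq n) * (5 / 11) ^ (n - j)"
    using assms(2) by auto
qed

lemma c_seq_nonneg: "c_seq n \<ge> 0"
  by (rule c_seq_growth(1)[of "n + 6"]) auto


section \<open>The determinant formula\<close>

theorem theorem2p3:
  fixes h :: "nat \<Rightarrow> real" and n :: nat
  assumes "\<And>k. k \<ge> 1 \<Longrightarrow> h k > 0"
    and "h 1 = 1"
    and "n \<ge> 2"
  shows "dArcais h n \<circ>\<^sub>p (- [:0, 1:]) =
           smult ((-1) ^ n / (\<Prod>k = 1..n. h k))
             ([:0, 1:] *
               det ([:0, 1:] \<cdot>\<^sub>m 1\<^sub>m (n - 1) - map_mat (\<lambda>a. [:a:]) (M_mat h n)))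
         \<and> (\<forall>i < n - 1. \<forall>j < n - 1. M_mat h n $$ (i, j) \<ge> 0)"
proof (rule conjI)
  show "\<forall>i < n - 1. \<forall>j < n - 1. M_mat h n $$ (i, j) \<ge> 0"
    using assms(1) by (auto simp: M_mat_def M_entry_def c_seq_nonneg less_imp_le)
next
  obtain m where n: "n = Suc (Suc m)"
    using assms(3) by (metis Suc_le_D numeral_2_eq_2 Suc_le_mono)
  define X :: "real poly" where "X = [:0, 1:]"
  define Q where "Q k = (-1) ^ k * (dArcais h k \<circ>\<^sub>p (- X))" for k
  define B where "B k = (\<Sum>i\<le>k. of_int (sigma_alt i) * Q (k - i))" for k
  \<comment> \<open>This is \<open>Q (Suc k)\<close> divided by \<open>X\<close>, obtained without
    polynomial division.\<close>
  define r where "r k = smult (1 / h (Suc k)) (B k)" for k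
  have B_r: "B k = smult (h (Suc k)) (r k)" for k
    using assms(1)[of "Suc k"] by (simp add: r_def)
  have Q_0: "Q 0 = 1"
    by (simp add: Q_def pcompose_1)
  \<comment> \<open>The factor \<open>- X\<close> from the substitution absorbs one of the
    \<open>Suc k\<close> signs in \<open>Q (Suc k)\<close>.\<close>
  have Q_Suc: "Q (Suc k) = X * r k" for k
  proof -
    have "B k = (-1) ^ k * (\<Sum>i\<le>k. of_nat (sigma (Suc i)) * (dArcais h (k - i) \<circ>\<^sub>p (- X)))"
      unfolding B_def Q_def sigma_alt_def sum_distrib_left
    proof (rule sum.cong)
      fix i assume "i \<in> {..k}"
      then have "(-1) ^ k = (-1) ^ i * (-1 :: real poly) ^ (k - i)"
        by (simp flip: power_add)
      then show "of_int ((-1) ^ i * int (sigma (Suc i))) * ((-1) ^ (k - i) * (dArcais h (k - i) \<circ>\<^sub>p (- X)))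
          = (-1) ^ k * (of_nat (sigma (Suc i)) * (dArcais h (k - i) \<circ>\<^sub>p (- X)))"
        by (simp add: mult_ac)
    qed simp
    also have "(\<Sum>i\<le>k. of_nat (sigma (Suc i)) * (dArcais h (k - i) \<circ>\<^sub>p (- X)))
        = (\<Sum>i = 1..Suc k. of_nat (sigma i) * (dArcais h (Suc k - i) \<circ>\<^sub>p (- X)))"
      by (simp only: sum.atLeast_Suc_atMost_Suc_shift One_nat_def atMost_atLeast0) simp
    finally have "B k = (-1) ^ k * (\<Sum>i = 1..Suc k. of_nat (sigma i) * (dArcais h (Suc k - i) \<circ>\<^sub>p (- X)))" .
    moreover have "dArcais h (Suc k) \<circ>\<^sub>p (- X) = smult (1 / h (Suc k))
        (- X * (\<Sum>i = 1..Suc k. of_nat (sigma i) * (dArcais h (Suc k - i) \<circ>\<^sub>p (- X))))"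
    proof -
      have "[:0, 1:] \<circ>\<^sub>p (- X) = - X"
        by (simp add: pcompose_pCons)
      moreover have "of_nat c \<circ>\<^sub>p (- X) = of_nat c" for c
        by (simp add: of_nat_poly)
      ultimately show ?thesis
        by (simp only: dArcais.simps(2) pcompose_smult pcompose_mult pcompose_sum)
    qed
    ultimately show ?thesis
      unfolding Q_def r_def by (simp add: mult_ac del: sum.cl_ivl_Suc)
  qed
  have conv: "(\<Sum>i\<le>k. of_int (c_seq (k - i)) * B i) = Q k" for k
  proof -
    have "(\<Sum>i\<le>k. of_int (c_seq (k - i)) * B i) = (\<Sum>i\<le>k. of_int (c_seq i) * B (k - i))"
      by (rule sum.reindex_bij_witness[of _ "\<lambda>i. k - i" "\<lambda>i. k - i"]) auto
    then show ?thesis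
      using c_seq_convolution_inverse[of B Q] by (simp add: B_def)
  qed

  define A where "A = X \<cdot>\<^sub>m 1\<^sub>m (n - 1) - map_mat (\<lambda>a. [:a:]) (M_mat h n)"
  have A: "A \<in> carrier_mat (Suc m) (Suc m)"
    by (intro carrier_matI) (simp_all add: A_def n M_mat_def)
  have A_entry: "A $$ (i, j) = (if i = j then X else 0)
      - (if j \<le> Suc i then smult (h (Suc j)) (of_int (c_seq (Suc i - j))) else 0)"
    if "i < Suc m" "j < Suc m" for i j
    using that by (simp add: A_def n M_mat_def M_entry_def of_int_poly mult.commute)
  define v where "v = vec (Suc m) r"
  \<comment> \<open>The factor \<open>h (Suc j)\<close> in column \<open>j\<close> of the matrix
    turns \<open>r j\<close> into \<open>B j\<close>.\<close>
  have Av: "(A *\<^sub>v v) $ i = X * r i - (\<Sum>j<Suc m. if j \<le> Suc i then of_int (c_seq (Suc i - j)) * B j else 0)"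
    if i: "i < Suc m" for i
  proof -
    have "(A *\<^sub>v v) $ i = (\<Sum>j<Suc m. A $$ (i, j) * r j)"
      using A i by (simp add: v_def scalar_prod_def lessThan_atLeast0)
    also have "\<dots> = (\<Sum>j<Suc m. (if i = j then X * r j else 0)
        - (if j \<le> Suc i then of_int (c_seq (Suc i - j)) * B j else 0))"
      using i by (intro sum.cong) (auto simp: A_entry B_r algebra_simps)
    finally show ?thesis
      using i by (simp only: sum_subtractf sum.delta finite_lessThan) simp
  qed
  have "det A = (A *\<^sub>v v) $ m * (\<Prod>i<m. - A $$ (i, Suc i))"
  proof (rule det_hessenberg[OF A])
    show "v $ 0 = 1"
      using assms(2) by (simp add: v_def r_def B_def Q_0)
    \<comment> \<open>For \<open>i < m\<close> the row contains the whole convolution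
      \<open>conv\<close>.\<close>
    show "(A *\<^sub>v v) $ i = 0" if "i < m" for i
    proof -
      have "(\<Sum>j<Suc m. if j \<le> Suc i then of_int (c_seq (Suc i - j)) * B j else 0)
          = (\<Sum>j\<le>Suc i. of_int (c_seq (Suc i - j)) * B j)"
        using that by (intro sum.mono_neutral_cong_right) auto
      then show ?thesis
        using Av[of i] that conv[of "Suc i"] by (simp add: Q_Suc)
    qed
  qed (auto simp: v_def A_entry)
  \<comment> \<open>The last row lacks only the term \<open>j = Suc m\<close>, whose coefficient is
    \<open>c_seq 0 = 1\<close>.\<close>
  also have "(A *\<^sub>v v) $ m = B (Suc m)"
  proof -
    have "(\<Sum>j<Suc m. if j \<le> Suc m then of_int (c_seq (Suc m - j)) * B j else 0) + B (Suc m)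
        = (\<Sum>j\<le>Suc m. of_int (c_seq (Suc m - j)) * B j)"
      by (simp add: lessThan_Suc_atMost)
    then have "(\<Sum>j<Suc m. if j \<le> Suc m then of_int (c_seq (Suc m - j)) * B j else 0) + B (Suc m)
        = X * r m"
      using conv[of "Suc m"] by (simp add: Q_Suc)
    then show ?thesis
      using Av[of m] by (simp add: algebra_simps)
  qed
  also have "(\<Prod>i<m. - A $$ (i, Suc i)) = (\<Prod>i<m. [:h (Suc (Suc i)):])"
    by (intro prod.cong) (auto simp: A_entry)
  also have "\<dots> = [:\<Prod>i<m. h (Suc (Suc i)):]"
    by (induction m) (auto simp: one_pCons)
  finally have det_A: "det A = smult (\<Prod>i<m. h (Suc (Suc i))) (B (Suc m))"
    by simp
  have "(\<Prod>k = 1..n. h k) = (\<Prod>i<n. h (Suc i))"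
    by (simp add: prod.atLeast1_atMost_eq)
  \<comment> \<open>The factor \<open>h 1 = 1\<close> drops out; \<open>h n\<close> is the
    denominator in \<open>r (Suc m)\<close>.\<close>
  also have "\<dots> = (\<Prod>i<m. h (Suc (Suc i))) * h n"
    unfolding n prod.lessThan_Suc[of _ "Suc m"] prod.lessThan_Suc_shift[of _ m]
    using assms(2) by simp
  finally have prod_h: "(\<Prod>k = 1..n. h k) = (\<Prod>i<m. h (Suc (Suc i))) * h n" .
  have "h (Suc (Suc i)) \<noteq> 0" for i
    using assms(1)[of "Suc (Suc i)"] by simp
  then have "smult ((-1) ^ n / (\<Prod>k = 1..n. h k)) (X * det A)
      = smult ((-1) ^ n) (X * r (Suc m))"
    unfolding prod_h det_A unfolding r_def n by simp
  also have "\<dots> = (-1) ^ n * Q n"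
    by (cases "even n") (simp_all add: n Q_Suc)
  also have "\<dots> = dArcais h n \<circ>\<^sub>p (- X)"
    by (simp add: Q_def flip: mult.assoc power_mult_distrib)
  finally show "dArcais h n \<circ>\<^sub>p (- [:0, 1:]) =
           smult ((-1) ^ n / (\<Prod>k = 1..n. h k))
             ([:0, 1:] *
               det ([:0, 1:] \<cdot>\<^sub>m 1\<^sub>m (n - 1) - map_mat (\<lambda>a. [:a:]) (M_mat h n)))"
    by (simp add: A_def X_def)
qed

end
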